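(* Let $m\ge2$, $n\ge1$ and let $\varphi^{(n)}$ be as defined in the context. For every $(v_1,\dots,v_n)\in\{0,\dots,m-1\}^n$, the $n$-th coordinate $\widetilde{\widetilde v}_n$ of $\varphi^{(n)}(v_1,\dots,v_n)$ is $$\widetilde{\widetilde v}_n=\Bigl(v_n+\sum_{i=1}^{n-1}2^{n-1-i}v_i\Bigr)\bmod m.$$
   Context: Fix $m\ge2$. Define maps $\varphi^{(n)}:\{0,\dots,m-1\}^n\to\{0,\dots,m-1\}^n$ recursively: $\varphi^{(1)}$ is the identity, and for $n\ge2$, $\varphi^{(n)}(v_1,v_2,\dots,v_n)=\bigl(v_1,\ \varphi^{(n-1)}((v_1+v_2)\bmod m,\dots,(v_1+v_n)\bmod m)\bigr)$. *)

theory Defs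
  imports Main
begin

text \<open>
  A vector of length \<open>n\<close> is a list of length \<open>n\<close>, and the upper index of \<open>\<phi>\<^sup>(\<^sup>n\<^sup>)\<close> is read off
  from the length of the argument.  The equation for the empty list only makes the function
  total.  Coordinates are counted from 1 in the mathematics, so \<open>v\<^sub>i\<close> is \<open>v ! (i - 1)\<close>.
\<close>

function phi :: "nat \<Rightarrow> nat list \<Rightarrow> nat list" where
  "phi m [] = []"
| "phi m [v] = [v]"
| "phi m (v # w # ws) = v # phi m (map (\<lambda>x. (v + x) mod m) (w # ws))"
  by pat_completeness auto
termination
  by (relation "measure (\<lambda>(m, vs). length vs)") auto

lemma length_phi: "length (phi m vs) = length vs"
  by (induction m vs rule: phi.induct) auto

lemma set_phi_subset:
  assumes "set vs \<subseteq> {..<m}"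
  shows "set (phi m vs) \<subseteq> {..<m}"
  using assms
proof (induction m vs rule: phi.induct)
  case (3 m v w ws)
  have "set (map (\<lambda>x. (v + x) mod m) (w # ws)) \<subseteq> {..<m}"
    using "3.prems" by auto
  then show ?case
    using "3.IH" "3.prems" by (simp del: list.map)
qed auto

end

theory Submission
  imports Defs
begin

text \<open>
  The shift by \<open>v\<^sub>1\<close> inside the recursion contributes \<open>v\<^sub>1\<close> once through the last
  coordinate and \<open>2\<^sup>n\<^sup>-\<^sup>2\<^sup>-\<^sup>i v\<^sub>1\<close> through the \<open>i\<close>-th coordinate of the tail, \<open>1 \<le> i \<le> n - 2\<close>;
  the geometric sum \<open>1 + (1 + 2 + \<dots> + 2\<^sup>n\<^sup>-\<^sup>3) = 2\<^sup>n\<^sup>-\<^sup>2\<close> is the coefficient of \<open>v\<^sub>1\<close>.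
\<close>

lemma sum_pow2_diff: "1 + (\<Sum>i<k. 2 ^ (k - Suc i)) = (2::nat) ^ k"
proof -
  have "(\<Sum>i<k. 2 ^ (k - Suc i)) = (\<Sum>i<k. (2::nat) ^ i)"
    by (rule sum.nat_diff_reindex)
  moreover have "1 + (\<Sum>i<k. 2 ^ i) = (2::nat) ^ k"
    by (induction k) auto
  ultimately show ?thesis by simp
qed

lemma mod_add_sum_mult_mod:
  fixes b :: nat
  shows "(b mod m + (\<Sum>i\<in>A. c i * (g i mod m))) mod m = (b + (\<Sum>i\<in>A. c i * g i)) mod m"
proof -
  have "(\<Sum>i\<in>A. c i * (g i mod m)) mod m = (\<Sum>i\<in>A. c i * g i) mod m"
    by (subst (1 2) mod_sum_eq [symmetric]) (simp add: mod_mult_right_eq)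
  then show ?thesis
    by (metis mod_add_eq mod_mod_trivial)
qed

lemma nth_phi_last:
  assumes "length v = Suc k" and "set v \<subseteq> {..<m}"
  shows "phi m v ! k = (v ! k + (\<Sum>i<k. 2 ^ (k - Suc i) * v ! i)) mod m"
  using assms
proof (induction k arbitrary: v)
  case 0
  then obtain a where "v = [a]" by (auto simp: length_Suc_conv)
  with 0 show ?case by simp
next
  case (Suc k)
  then obtain a w where v: "v = a # w" and len: "length w = Suc k"
    by (auto simp: length_Suc_conv)
  define u where "u = map (\<lambda>x. (a + x) mod m) w"
  \<comment> \<open>This gives \<open>m > 0\<close>, so the residues in \<open>u\<close> lie below
    \<open>m\<close>.\<close>
  have "a < m" using Suc.prems v by simp
  then have u: "length u = Suc k" "set u \<subseteq> {..<m}"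
    using len by (auto simp: u_def)
  \<comment> \<open>By \<open>len\<close>, \<open>w\<close> is nonempty, so the third equation of
    \<open>phi\<close> applies.\<close>
  have "phi m v = a # phi m u"
    using len by (cases w) (simp_all add: v u_def)
  then have "phi m v ! Suc k = (u ! k + (\<Sum>i<k. 2 ^ (k - Suc i) * u ! i)) mod m"
    using Suc.IH [OF u] by simp
  also have "\<dots> = ((a + w ! k) mod m + (\<Sum>i<k. 2 ^ (k - Suc i) * ((a + w ! i) mod m))) mod m"
    using len by (simp add: u_def)
  also have "\<dots> = ((a + w ! k) + (\<Sum>i<k. 2 ^ (k - Suc i) * (a + w ! i))) mod m"
    by (rule mod_add_sum_mult_mod)
  also have "(a + w ! k) + (\<Sum>i<k. 2 ^ (k - Suc i) * (a + w ! i))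
      = w ! k + (1 + (\<Sum>i<k. 2 ^ (k - Suc i))) * a + (\<Sum>i<k. 2 ^ (k - Suc i) * w ! i)"
    by (simp add: distrib_left distrib_right sum.distrib sum_distrib_right)
  also have "\<dots> = w ! k + 2 ^ k * a + (\<Sum>i<k. 2 ^ (k - Suc i) * w ! i)"
    by (simp only: sum_pow2_diff)
  \<comment> \<open>\<open>2 ^ k * a\<close> is the term \<open>i = 0\<close> of the new sum, which
    is therefore split at its lower end.\<close>
  also have "\<dots> = v ! Suc k + (\<Sum>i<Suc k. 2 ^ (Suc k - Suc i) * v ! i)"
    by (simp add: v sum.lessThan_Suc_shift del: sum.lessThan_Suc)
  finally show ?case .
qed

theorem theorem3:
  fixes m n :: nat and v :: "nat list"
  assumes "m \<ge> 2" and "n \<ge> 1"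
    and "length v = n" and "set v \<subseteq> {..<m}"
  shows "phi m v ! (n - 1)
       = (v ! (n - 1) + (\<Sum>i = 1..n - 1. 2 ^ (n - 1 - i) * v ! (i - 1))) mod m"
proof -
  have "length v = Suc (n - 1)" using assms by simp
  moreover have "(\<Sum>i = 1..n - 1. 2 ^ (n - 1 - i) * v ! (i - 1))
      = (\<Sum>i<n - 1. 2 ^ (n - 1 - Suc i) * v ! i)"
    by (simp add: sum.atLeast1_atMost_eq)
  ultimately show ?thesis
    using nth_phi_last assms(4) by presburger
qed

end
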